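(* For $n=2$, the natural density $\rho(\overline E)$ of the set $\overline E\subseteq\mathbb{Z}^3$ of shifted Eisenstein polynomials of degree $2$ exists and equals $1$.
   Context: Polynomials in $\mathbb{Z}[x]$ of degree at most $n$ are identified with $\mathbb{Z}^{n+1}$ via their coefficients in the basis $\{1,x,\dots,x^n\}$; here $n=2$. A polynomial $f(x)=\sum_{i=0}^n\alpha_i x^i\in\mathbb{Z}[x]$ of degree $n$ is $p$-Eisenstein, for a prime $p$, if $p\nmid\alpha_n$, $p\mid\alpha_i$ for all $i\in\{0,\dots,n-1\}$, and $p^2\nmid\alpha_0$. It is Eisenstein if it is $p$-Eisenstein for some prime $p$. Let $E\subseteq\mathbb{Z}^{n+1}$ be the set of Eisenstein polynomials of degree (exactly) $n$. The set of shifted Eisenstein polynomials of degree $n$ is $\overline E=\{f(x)\in\mathbb{Z}^{n+1} : f(x+i)\in E \text{ for some } i\in\mathbb{Z}\}$. For $A\subseteq\mathbb{Z}^d$, the natural density of $A$ is $\rho(A)=\lim_{B\to\infty}\frac{|A\cap[-B,B)^d|}{(2B)^d}$, when the limit exists. Here $d=n+1=3$. *)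

theory Defs
  imports Complex_Main "HOL-Computational_Algebra.Computational_Algebra"
begin

definition eisenstein_at :: "int \<Rightarrow> int poly \<Rightarrow> bool" where
  "eisenstein_at p f \<longleftrightarrow>
     \<not> p dvd lead_coeff f \<and> (\<forall>i<degree f. p dvd coeff f i) \<and> \<not> p\<^sup>2 dvd coeff f 0"

definition eisenstein_polys :: "nat \<Rightarrow> int poly set" where
  "eisenstein_polys n = {f. degree f = n \<and> (\<exists>p. prime p \<and> eisenstein_at p f)}"

text \<open>The composition \<^term>\<open>pcompose f [:i, 1:]\<close> is the shifted polynomial $f(x+i)$.\<close>

definition shifted_eisenstein_polys :: "nat \<Rightarrow> int poly set" where
  "shifted_eisenstein_polys n =
     {f. degree f \<le> n \<and> (\<exists>i::int. pcompose f [:i, 1:] \<in> eisenstein_polys n)}"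

text \<open>Points of $\mathbb{Z}^d$ are integer lists of length \<open>d\<close>; a polynomial of degree at most
  \<open>n\<close> is identified with its coefficient list with respect to $1, x, \dots, x^n$.\<close>

definition coeff_vec :: "nat \<Rightarrow> int poly \<Rightarrow> int list" where
  "coeff_vec n f = map (coeff f) [0..<n + 1]"

lemma bij_betw_coeff_vec:
  "bij_betw (coeff_vec n) {f. degree f \<le> n} {v. length v = n + 1}"
proof (rule bij_betw_byWitness[where f' = Poly])
  show "\<forall>f\<in>{f. degree f \<le> n}. Poly (coeff_vec n f) = f"
    by (auto simp: coeff_vec_def poly_eq_iff nth_default_def coeff_eq_0 simp del: upt_Suc)
  show "\<forall>v\<in>{v. length v = n + 1}. coeff_vec n (Poly v) = v"
    by (auto simp: coeff_vec_def list_eq_iff_nth_eq nth_default_def simp del: upt_Suc)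
  show "coeff_vec n ` {f. degree f \<le> n} \<subseteq> {v. length v = n + 1}"
    by (auto simp: coeff_vec_def)
  have "degree (Poly v) \<le> n" if "length v = n + 1" for v :: "int list"
    using that by (intro degree_le) (auto simp: nth_default_def)
  then show "Poly ` {v. length v = n + 1} \<subseteq> {f :: int poly. degree f \<le> n}"
    by auto
qed

definition int_box :: "nat \<Rightarrow> nat \<Rightarrow> int list set" where
  "int_box d B = {v. length v = d \<and> set v \<subseteq> {- int B..<int B}}"

definition has_natural_density :: "nat \<Rightarrow> int list set \<Rightarrow> real \<Rightarrow> bool" where
  "has_natural_density d A r \<longleftrightarrow>
     (\<lambda>B. real (card (A \<inter> int_box d B)) / (2 * real B) ^ d) \<longlonglongrightarrow> r"

end

theory Submission
  imports Defs "HOL-Number_Theory.Cong"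
begin

text \<open>
  Completing the square shows that a quadratic $f = ax^2+bx+c$ has a $p$-Eisenstein shift, for an odd
  prime $p \nmid a$, as soon as $p$ divides the discriminant $b^2-4ac$ exactly once: choose $i$ with
  $p \mid 2ai+b$, and compare $4a f(i) = (2ai+b)^2 - (b^2-4ac)$ modulo $p^2$
  (\<open>simple_disc_imp_shifted_eisenstein\<close>).  So a quadratic outside the set in question fails this
  condition at every odd prime.

  The condition at $p$ depends only on the coefficients modulo $p^2$, and it holds for a proportion
  of at least $(p-1)^2/p^3 \ge 4/(9p)$ of the residues.  By the Chinese remainder theorem the
  conditions at different primes are independent, so the proportion of quadratics failing at all
  primes of a finite set $S$ is at most
  $\prod_{p \in S} (1 - 4/(9p)) \le \exp(-\frac49 \sum_{p \in S} 1/p)$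
  (\<open>card_residues3_no_simple_disc_le\<close>); counting lattice points of a box by residue class
  turns this into a bound on the upper density (\<open>card_box_not_shifted_eisenstein_le\<close>).  Since
  the sum of the reciprocals of the primes diverges (\<open>not_summable_prime_reciprocals\<close>), the
  bound can be made arbitrarily small.
\<close>

section \<open>Eisenstein shifts and the discriminant\<close>

text \<open>A triple \<open>(a, b, c)\<close> stands for $ax^2+bx+c$, leading coefficient first; the coefficient vector
  of this polynomial is the reversed list \<open>[c, b, a]\<close>.\<close>

definition simple_disc_at :: "int \<Rightarrow> int \<times> int \<times> int \<Rightarrow> bool" where
  "simple_disc_at p = (\<lambda>(a, b, c).
     \<not> p dvd a \<and> p dvd b\<^sup>2 - 4 * a * c \<and> \<not> p\<^sup>2 dvd b\<^sup>2 - 4 * a * c)"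

lemma coprime_4_times:
  fixes p a :: int
  assumes "prime p" "p > 2" "\<not> p dvd a"
  shows "coprime (4 * a) (p\<^sup>2)"
proof -
  have "\<not> p dvd 2"
    using assms(2) zdvd_imp_le by fastforce
  then have "\<not> p dvd 2 * 2"
    using assms(1) prime_dvd_mult_iff by blast
  then have "\<not> p dvd 4 * a"
    using assms by (simp add: prime_dvd_mult_iff)
  then have "coprime (4 * a) p"
    using assms(1) by (metis coprime_commute prime_imp_coprime)
  then show ?thesis
    by (rule coprime_power_right_iff[THEN iffD2, OF disjI1])
qed

text \<open>The shift moves the root of $f'$ modulo $p$ to the origin.  The square in
  $4a f(i) = (2ai+b)^2 - (b^2-4ac)$ then vanishes modulo $p^2$, so that $f(i)$, like
  the discriminant, is divisible by $p$ but not by $p^2$.\<close>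

lemma simple_disc_imp_shifted_eisenstein:
  fixes p a b c :: int
  assumes p: "prime p" "p > 2" and v: "simple_disc_at p (a, b, c)"
  shows "[c, b, a] \<in> coeff_vec 2 ` shifted_eisenstein_polys 2"
proof -
  have a: "\<not> p dvd a" and d: "p dvd b\<^sup>2 - 4 * a * c" "\<not> p\<^sup>2 dvd b\<^sup>2 - 4 * a * c"
    using v by (auto simp: simple_disc_at_def)
  have c4: "coprime (4 * a) (p\<^sup>2)"
    by (rule coprime_4_times[OF p a])
  then have c2: "coprime (2 * a) p"
    by auto
  obtain u where u: "[2 * a * u = 1] (mod p)"
    using cong_solve_coprime_int[OF c2] by auto
  \<comment> \<open>the solution of $2ai+b \equiv 0 \pmod p$\<close>
  define i where "i = - b * u"
  have "[2 * a * i + b = - b * (2 * a * u) + b] (mod p)"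
    by (simp add: i_def algebra_simps)
  also have "[- b * (2 * a * u) + b = - b * 1 + b] (mod p)"
    by (intro cong_add cong_mult u) auto
  finally have b': "p dvd 2 * a * i + b"
    by (simp add: cong_0_iff)
  define g where "g = a * i\<^sup>2 + b * i + c"
  have disc: "4 * a * g = (2 * a * i + b)\<^sup>2 - (b\<^sup>2 - 4 * a * c)"
    by (simp add: g_def power2_eq_square algebra_simps)
  have sq: "p\<^sup>2 dvd (2 * a * i + b)\<^sup>2"
    using b' by (simp add: dvd_power_same)
  then have "p dvd (2 * a * i + b)\<^sup>2"
    by (meson dvd_power dvd_trans pos2)
  then have "p dvd 4 * a * g"
    unfolding disc using d(1) by (rule dvd_diff)
  moreover have "coprime p (4 * a)"
    using c4 by (auto simp: coprime_commute)
  ultimately have g1: "p dvd g"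
    by (simp add: coprime_dvd_mult_right_iff)
  have g2: "\<not> p\<^sup>2 dvd g"
  proof
    assume "p\<^sup>2 dvd g"
    then have "p\<^sup>2 dvd (2 * a * i + b)\<^sup>2 - 4 * a * g"
      using sq by (intro dvd_diff) auto
    then show False
      using d(2) by (simp add: disc)
  qed
  have a0: "a \<noteq> 0"
    using a by auto
  define f where "f = [:c, b, a:]"
  have comp: "pcompose f [:i, 1:] = [:g, 2 * a * i + b, a:]"
    by (simp add: f_def g_def pcompose_pCons power2_eq_square algebra_simps)
  have "eisenstein_at p (pcompose f [:i, 1:])"
    unfolding comp eisenstein_at_def
    using a a0 b' g1 g2 by (auto simp: less_Suc_eq numeral_2_eq_2)
  then have "pcompose f [:i, 1:] \<in> eisenstein_polys 2"
    using p a0 by (auto simp: eisenstein_polys_def comp)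
  then have "f \<in> shifted_eisenstein_polys 2"
    by (auto simp: shifted_eisenstein_polys_def f_def)
  moreover have "coeff_vec 2 f = [c, b, a]"
    by (simp add: coeff_vec_def f_def numeral_2_eq_2)
  ultimately show ?thesis by (metis imageI)
qed

section \<open>Counting residues modulo the square of a prime\<close>

definition reduce :: "int \<Rightarrow> int \<times> int \<times> int \<Rightarrow> int \<times> int \<times> int" where
  "reduce m = (\<lambda>(a, b, c). (a mod m, b mod m, c mod m))"

definition residues3 :: "int \<Rightarrow> (int \<times> int \<times> int) set" where
  "residues3 m = {0..<m} \<times> {0..<m} \<times> {0..<m}"

lemma finite_residues3 [simp]: "finite (residues3 m)"
  by (simp add: residues3_def)

lemma card_residues3: "m \<ge> 0 \<Longrightarrow> card (residues3 m) = nat m ^ 3"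
  by (simp add: residues3_def power3_eq_cube)

lemma reduce_in_residues3: "m > 0 \<Longrightarrow> reduce m v \<in> residues3 m"
  by (cases v) (simp add: reduce_def residues3_def)

lemma simple_disc_at_cong:
  assumes "[a = a'] (mod p\<^sup>2)" "[b = b'] (mod p\<^sup>2)" "[c = c'] (mod p\<^sup>2)"
  shows "simple_disc_at p (a, b, c) \<longleftrightarrow> simple_disc_at p (a', b', c')"
proof -
  have D: "[b\<^sup>2 - 4 * a * c = b'\<^sup>2 - 4 * a' * c'] (mod p\<^sup>2)"
    by (intro cong_diff cong_mult cong_pow assms cong_refl)
  have pp: "p dvd p\<^sup>2"
    by simp
  show ?thesis
    unfolding simple_disc_at_def
    using cong_dvd_iff[OF D] cong_dvd_iff[OF cong_dvd_modulus[OF D pp]]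
      cong_dvd_iff[OF cong_dvd_modulus[OF assms(1) pp]] by simp
qed

lemma simple_disc_at_reduce:
  assumes "p\<^sup>2 dvd m"
  shows "simple_disc_at p (reduce m v) \<longleftrightarrow> simple_disc_at p v"
proof -
  have *: "[x mod m = x] (mod p\<^sup>2)" for x
    using assms by (meson cong_dvd_modulus cong_mod_left cong_refl)
  show ?thesis
    by (cases v) (simp add: reduce_def simple_disc_at_cong[OF * * *])
qed

lemma card_units_prime_square:
  fixes p :: int
  assumes "p > 0"
  shows "card {a \<in> {0..<p\<^sup>2}. \<not> p dvd a} = nat p * (nat p - 1)"
proof -
  have eq: "{a \<in> {0..<p\<^sup>2}. \<not> p dvd a} = {0..<p\<^sup>2} - (*) p ` {0..<p}"
    using assms by (auto simp: power2_eq_square zero_le_mult_iff elim!: dvdE)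
  have sub: "(*) p ` {0..<p} \<subseteq> {0..<p\<^sup>2}"
    using assms by (auto simp: power2_eq_square)
  have "card ((*) p ` {0..<p}) = nat p"
    using assms by (subst card_image) (auto simp: inj_on_def)
  then have "card {a \<in> {0..<p\<^sup>2}. \<not> p dvd a} = nat (p\<^sup>2) - nat p"
    unfolding eq by (subst card_Diff_subset) (use sub in auto)
  then show ?thesis
    using assms by (simp add: power2_eq_square nat_mult_distrib diff_mult_distrib2)
qed

text \<open>Once a unit $a$ and any $b$ are chosen, the discriminant $b^2-4ac$ runs through every residue
  modulo $p^2$ exactly once as $c$ varies, because $4a$ is invertible; the $p-1$ values $pk$ with
  $0 < k < p$ are the admissible ones.  Hence the count is $p(p-1) \cdot p^2 \cdot (p-1)$.\<close>

lemma card_simple_disc_residues_ge: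
  fixes p :: int
  assumes p: "prime p" "p > 2"
  shows "nat p ^ 3 * (nat p - 1)\<^sup>2 \<le> card {v \<in> residues3 (p\<^sup>2). simple_disc_at p v}"
proof -
  define U where "U = {a \<in> {0..<p\<^sup>2}. \<not> p dvd a}"
  define S where "S = U \<times> {0..<p\<^sup>2} \<times> {1..<p}"
  have p2: "p\<^sup>2 > 0"
    using p by simp
  have "\<exists>u. [4 * a * u = 1] (mod p\<^sup>2)" if "\<not> p dvd a" for a
    using cong_solve_coprime_int[OF coprime_4_times[OF p that]] by blast
  then obtain u where u: "\<And>a. \<not> p dvd a \<Longrightarrow> [4 * a * u a = 1] (mod p\<^sup>2)"
    by metis
  \<comment> \<open>parametrises admissible triples by $(a, b, k)$, solving $b^2-4ac \equiv pk$ for $c$\<close>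
  define F where "F = (\<lambda>(a, b, k). (a, b, (b\<^sup>2 - p * k) * u a mod p\<^sup>2))"
  have disc: "[b\<^sup>2 - 4 * a * ((b\<^sup>2 - p * k) * u a mod p\<^sup>2) = p * k] (mod p\<^sup>2)"
    if "\<not> p dvd a" for a b k
  proof -
    have "[4 * a * ((b\<^sup>2 - p * k) * u a mod p\<^sup>2) = 4 * a * ((b\<^sup>2 - p * k) * u a)] (mod p\<^sup>2)"
      by (intro cong_mult cong_refl) simp
    also have "4 * a * ((b\<^sup>2 - p * k) * u a) = (4 * a * u a) * (b\<^sup>2 - p * k)"
      by simp
    also have "[\<dots> = 1 * (b\<^sup>2 - p * k)] (mod p\<^sup>2)"
      by (intro cong_mult cong_refl u that)
    finally have "[b\<^sup>2 - 4 * a * ((b\<^sup>2 - p * k) * u a mod p\<^sup>2) = b\<^sup>2 - 1 * (b\<^sup>2 - p * k)] (mod p\<^sup>2)"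
      by (intro cong_diff cong_refl)
    then show ?thesis
      by simp
  qed
  have "inj_on F S"
  proof (rule inj_onI, clarsimp simp: F_def S_def U_def)
    fix a b k l
    assume a: "\<not> p dvd a" and k: "1 \<le> k" "k < p" and l: "1 \<le> l" "l < p"
      and eq: "(b\<^sup>2 - p * k) * u a mod p\<^sup>2 = (b\<^sup>2 - p * l) * u a mod p\<^sup>2"
    have "[p * k = p * l] (mod p\<^sup>2)"
      using disc[OF a, of b k] disc[OF a, of b l] unfolding eq
      by (meson cong_sym cong_trans)
    then have "p\<^sup>2 dvd p * (k - l)"
      by (simp add: cong_iff_dvd_diff right_diff_distrib)
    then have "p dvd k - l"
      using p by (simp add: power2_eq_square)
    then have "[k = l] (mod p)"
      by (simp add: cong_iff_dvd_diff)
    then show "k = l"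
      using k l by (simp add: cong_def)
  qed
  moreover have "F ` S \<subseteq> {v \<in> residues3 (p\<^sup>2). simple_disc_at p v}"
  proof (clarsimp simp: F_def S_def U_def residues3_def p2 simple_disc_at_def)
    fix a b k
    assume a: "\<not> p dvd a" and k: "1 \<le> k" "k < p"
    let ?D = "b\<^sup>2 - 4 * a * ((b\<^sup>2 - p * k) * u a mod p\<^sup>2)"
    have "p dvd ?D"
      using cong_dvd_iff[OF cong_dvd_modulus[OF disc[OF a, of b k], of p]] by simp
    moreover have "\<not> p\<^sup>2 dvd ?D"
    proof
      assume "p\<^sup>2 dvd ?D"
      then have "p\<^sup>2 dvd p * k"
        using cong_dvd_iff[OF disc[OF a, of b k]] by simp
      then have "p dvd k"
        using p by (simp add: power2_eq_square)
      then show False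
        using k zdvd_imp_le by fastforce
    qed
    ultimately show "p dvd ?D \<and> \<not> p\<^sup>2 dvd ?D"
      by blast
  qed
  ultimately have "card S \<le> card {v \<in> residues3 (p\<^sup>2). simple_disc_at p v}"
    by (intro card_inj_on_le) auto
  moreover have "card S = nat p * (nat p - 1) * (nat p ^ 2 * (nat p - 1))"
    using p card_units_prime_square[of p]
    by (simp add: S_def U_def card_cartesian_product nat_power_eq nat_diff_distrib)
  ultimately show ?thesis
    by (simp add: power2_eq_square power3_eq_cube mult_ac)
qed

text \<open>The proportion of admissible triples is $(p-1)^2/p^3$; the constant $4/9$ is the value of
  $((p-1)/p)^2$ at the smallest odd prime.  The exponential form makes products over several
  primes into sums of reciprocals.\<close>

lemma card_not_simple_disc_residues_le:
  fixes p :: int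
  assumes p: "prime p" "p > 2"
  shows "real (card {v \<in> residues3 (p\<^sup>2). \<not> simple_disc_at p v})
           \<le> (real_of_int p ^ 2) ^ 3 * exp (- 4 / (9 * real_of_int p))"
proof -
  let ?G = "{v \<in> residues3 (p\<^sup>2). simple_disc_at p v}"
  define q where "q = real_of_int p"
  have q: "q \<ge> 3"
    using p by (simp add: q_def)
  have "{v \<in> residues3 (p\<^sup>2). \<not> simple_disc_at p v} = residues3 (p\<^sup>2) - ?G"
    by auto
  then have "card {v \<in> residues3 (p\<^sup>2). \<not> simple_disc_at p v} + card ?G = card (residues3 (p\<^sup>2))"
    by (simp add: card_Diff_subset card_mono)
  also have "\<dots> = (nat p ^ 2) ^ 3"
    using p by (simp add: card_residues3 nat_power_eq)
  finally have "real (card {v \<in> residues3 (p\<^sup>2). \<not> simple_disc_at p v} + card ?G)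
      = real ((nat p ^ 2) ^ 3)"
    by (rule arg_cong)
  then have "real (card {v \<in> residues3 (p\<^sup>2). \<not> simple_disc_at p v}) + real (card ?G) = (q ^ 2) ^ 3"
    using p by (simp add: q_def)
  moreover have "q ^ 3 * (q - 1)\<^sup>2 \<le> real (card ?G)"
  proof -
    have "real (nat p ^ 3 * (nat p - 1)\<^sup>2) = q ^ 3 * (q - 1)\<^sup>2"
      using p by (simp add: q_def of_nat_diff)
    then show ?thesis
      using of_nat_mono[OF card_simple_disc_residues_ge[OF p], where 'a = real] by simp
  qed
  moreover have "(4 / 9) * q\<^sup>2 \<le> (q - 1)\<^sup>2"
  proof -
    have "(2 / 3 * q)\<^sup>2 \<le> (q - 1)\<^sup>2"
      using q by (intro power_mono) auto
    then show ?thesis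
      by (simp add: power2_eq_square)
  qed
  then have "q ^ 3 * ((4 / 9) * q\<^sup>2) \<le> q ^ 3 * (q - 1)\<^sup>2"
    using q by (intro mult_left_mono) auto
  ultimately have "real (card {v \<in> residues3 (p\<^sup>2). \<not> simple_disc_at p v})
      \<le> (q ^ 2) ^ 3 - q ^ 3 * ((4 / 9) * q\<^sup>2)"
    by linarith
  also have "\<dots> = (q ^ 2) ^ 3 * (1 + - 4 / (9 * q))"
    using q by (simp add: field_simps power2_eq_square power3_eq_cube)
  also have "\<dots> \<le> (q ^ 2) ^ 3 * exp (- 4 / (9 * q))"
    using q by (intro mult_left_mono exp_ge_add_one_self) auto
  finally show ?thesis
    by (simp add: q_def)
qed

section \<open>Independence of different primes\<close>

text \<open>An upper bound needs only one half of the Chinese remainder theorem, namely that a residue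
  modulo $mn$ is determined by its residues modulo $m$ and $n$.\<close>

lemma card_residues3_mult_le:
  fixes m n :: int
  assumes "m > 0" "n > 0" "coprime m n"
    and P: "\<And>v. P (reduce m v) \<longleftrightarrow> P v" and Q: "\<And>v. Q (reduce n v) \<longleftrightarrow> Q v"
  shows "card {v \<in> residues3 (m * n). P v \<and> Q v}
           \<le> card {v \<in> residues3 m. P v} * card {v \<in> residues3 n. Q v}"
proof -
  let ?X = "{v \<in> residues3 (m * n). P v \<and> Q v}"
  have eqI: "x = y" if "x mod m = y mod m" "x mod n = y mod n" "x \<in> {0..<m * n}" "y \<in> {0..<m * n}" for x y
  proof -
    have "[x = y] (mod m * n)"
      using that assms(3) by (intro coprime_cong_mult) (auto simp: cong_def)
    then show ?thesis
      using that by (simp add: cong_def)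
  qed
  have "inj_on (\<lambda>v. (reduce m v, reduce n v)) ?X"
  proof (rule inj_onI)
    fix v w
    assume vw: "v \<in> ?X" "w \<in> ?X" "(reduce m v, reduce n v) = (reduce m w, reduce n w)"
    obtain a b c a' b' c' where eqs: "v = (a, b, c)" "w = (a', b', c')"
      using prod_cases3 by metis
    have "a = a'" "b = b'" "c = c'"
      using vw by (auto simp: eqs reduce_def residues3_def intro!: eqI[of a a'] eqI[of b b'] eqI[of c c'])
    then show "v = w"
      by (simp add: eqs)
  qed
  moreover have "(\<lambda>v. (reduce m v, reduce n v)) ` ?X
                   \<subseteq> {v \<in> residues3 m. P v} \<times> {v \<in> residues3 n. Q v}"
    using assms by (auto intro: reduce_in_residues3)
  ultimately have "card ?X \<le> card ({v \<in> residues3 m. P v} \<times> {v \<in> residues3 n. Q v})"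
    by (intro card_inj_on_le) auto
  then show ?thesis
    by (simp add: card_cartesian_product)
qed

lemma card_residues3_no_simple_disc_le:
  fixes S :: "int set"
  assumes "finite S" "\<And>p. p \<in> S \<Longrightarrow> prime p \<and> p > 2"
  shows "real (card {v \<in> residues3 (\<Prod>p\<in>S. p\<^sup>2). \<forall>p\<in>S. \<not> simple_disc_at p v})
           \<le> real_of_int (\<Prod>p\<in>S. p\<^sup>2) ^ 3 * exp (- 4 / 9 * (\<Sum>p\<in>S. 1 / real_of_int p))"
  using assms
proof (induction S rule: finite_induct)
  case empty
  then show ?case
    by (simp add: card_residues3)
next
  case (insert p S)
  define M where "M = (\<Prod>p\<in>S. p\<^sup>2)"
  let ?X = "{v \<in> residues3 (p\<^sup>2). \<not> simple_disc_at p v}"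
  let ?Y = "{v \<in> residues3 M. \<forall>p\<in>S. \<not> simple_disc_at p v}"
  have p: "prime p" "p > 2"
    using insert.prems by auto
  have M: "M > 0"
    unfolding M_def using insert.prems by (intro prod_pos) fastforce
  have "coprime (p\<^sup>2) M"
    unfolding M_def
  proof (intro prod_coprime_right)
    fix q assume q: "q \<in> S"
    then have "prime q" "p \<noteq> q"
      using insert by auto
    then show "coprime (p\<^sup>2) (q\<^sup>2)"
      using p primes_coprime by (metis coprime_power_left_iff coprime_power_right_iff)
  qed
  moreover have "(\<forall>q\<in>S. \<not> simple_disc_at q (reduce M v)) \<longleftrightarrow> (\<forall>q\<in>S. \<not> simple_disc_at q v)" for v
    unfolding M_def using insert.hyps
    by (intro ball_cong refl) (simp add: simple_disc_at_reduce dvd_prod_eqI)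
  ultimately have "card {v \<in> residues3 (p\<^sup>2 * M). \<not> simple_disc_at p v \<and> (\<forall>p\<in>S. \<not> simple_disc_at p v)}
      \<le> card ?X * card ?Y"
    using p M by (intro card_residues3_mult_le) (auto simp: simple_disc_at_reduce)
  moreover have "(\<Prod>p\<in>insert p S. p\<^sup>2) = p\<^sup>2 * M"
    using insert.hyps by (simp add: M_def)
  ultimately have "real (card {v \<in> residues3 (\<Prod>p\<in>insert p S. p\<^sup>2). \<forall>p\<in>insert p S. \<not> simple_disc_at p v})
      \<le> real (card ?X) * real (card ?Y)"
    by (simp flip: of_nat_mult)
  also have "\<dots> \<le> ((real_of_int p ^ 2) ^ 3 * exp (- 4 / (9 * real_of_int p)))
      * (real_of_int M ^ 3 * exp (- 4 / 9 * (\<Sum>p\<in>S. 1 / real_of_int p)))"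
    using insert.IH insert.prems p
    by (intro mult_mono card_not_simple_disc_residues_le) (auto simp: M_def)
  also have "\<dots> = real_of_int (p\<^sup>2 * M) ^ 3 * exp (- 4 / 9 * (\<Sum>p\<in>insert p S. 1 / real_of_int p))"
  proof -
    have "- 4 / 9 * (\<Sum>p\<in>insert p S. 1 / real_of_int p)
        = - 4 / (9 * real_of_int p) + - 4 / 9 * (\<Sum>p\<in>S. 1 / real_of_int p)"
      using insert.hyps by (simp add: algebra_simps)
    then show ?thesis
      unfolding exp_add[symmetric] by (simp only: exp_add of_int_mult of_int_power power_mult_distrib mult_ac)
  qed
  finally show ?case
    using insert.hyps by (simp add: M_def)
qed

section \<open>From residues to boxes\<close>

text \<open>Elements of one residue class are told apart by their quotients, which lie in an interval
  of length $2B/m$; rounding its two ends costs at most $2$.\<close>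

lemma card_interval_residue_le:
  fixes m :: int
  assumes "m > 0"
  shows "real (card {x \<in> {- int B..<int B}. x mod m = r}) \<le> 2 * real B / real_of_int m + 2"
proof (cases "B = 0")
  case False
  let ?X = "{x \<in> {- int B..<int B}. x mod m = r}"
  have "inj_on (\<lambda>x. x div m) ?X"
    by (rule inj_onI, clarify) (metis mult_div_mod_eq)
  moreover have "(\<lambda>x. x div m) ` ?X \<subseteq> {(- int B) div m..int B div m}"
  proof clarify
    fix x assume "x \<in> {- int B..<int B}"
    then show "x div m \<in> {(- int B) div m..int B div m}"
      using assms zdiv_mono1[of "- int B" x m] zdiv_mono1[of x "int B" m] by simp
  qed
  ultimately have "card ?X \<le> card {(- int B) div m..int B div m}"
    by (intro card_inj_on_le) auto
  then have "real (card ?X) \<le> real_of_int (int B div m - (- int B) div m + 1)"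
    using zdiv_mono1[of "- int B" "int B" m] assms by simp
  moreover have "real_of_int (int B div m) \<le> real B / real_of_int m"
    by (metis of_int_floor_le floor_divide_of_int_eq of_int_of_nat_eq)
  moreover have "real_of_int ((- int B) div m) \<ge> - real B / real_of_int m - 1"
    by (metis floor_divide_of_int_eq of_int_of_nat_eq of_int_minus real_of_int_floor_gt_diff_one less_imp_le)
  ultimately show ?thesis
    by simp
qed auto

lemma card_box_periodic_le:
  fixes m :: int
  assumes "m > 0" and P: "\<And>v. P (reduce m v) \<longleftrightarrow> P v"
  shows "real (card {v \<in> {- int B..<int B} \<times> {- int B..<int B} \<times> {- int B..<int B}. P v})
           \<le> real (card {v \<in> residues3 m. P v}) * (2 * real B / real_of_int m + 2) ^ 3"
proof -
  let ?I = "{- int B..<int B}"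
  let ?R = "{v \<in> residues3 m. P v}"
  have fibre: "real (card {v \<in> ?I \<times> ?I \<times> ?I. reduce m v = w}) \<le> (2 * real B / real_of_int m + 2) ^ 3" for w
  proof -
    obtain r s t where w: "w = (r, s, t)"
      using prod_cases3 by blast
    let ?J = "\<lambda>r. {x \<in> ?I. x mod m = r}"
    have "{v \<in> ?I \<times> ?I \<times> ?I. reduce m v = w} = ?J r \<times> ?J s \<times> ?J t"
      by (auto simp: w reduce_def)
    then have "real (card {v \<in> ?I \<times> ?I \<times> ?I. reduce m v = w})
        = real (card (?J r)) * (real (card (?J s)) * real (card (?J t)))"
      by (simp only: card_cartesian_product of_nat_mult)
    also have "\<dots> \<le> (2 * real B / real_of_int m + 2) *
        ((2 * real B / real_of_int m + 2) * (2 * real B / real_of_int m + 2))"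
      using assms(1) by (intro mult_mono card_interval_residue_le) auto
    finally show ?thesis
      by (simp add: power3_eq_cube)
  qed
  have "{v \<in> ?I \<times> ?I \<times> ?I. P v} \<subseteq> (\<Union>w\<in>?R. {v \<in> ?I \<times> ?I \<times> ?I. reduce m v = w})"
    using assms by (auto intro: reduce_in_residues3)
  then have "card {v \<in> ?I \<times> ?I \<times> ?I. P v} \<le> card (\<Union>w\<in>?R. {v \<in> ?I \<times> ?I \<times> ?I. reduce m v = w})"
    by (intro card_mono) auto
  also have "\<dots> \<le> (\<Sum>w\<in>?R. card {v \<in> ?I \<times> ?I \<times> ?I. reduce m v = w})"
    by (intro card_UN_le) auto
  finally have "real (card {v \<in> ?I \<times> ?I \<times> ?I. P v})
      \<le> (\<Sum>w\<in>?R. real (card {v \<in> ?I \<times> ?I \<times> ?I. reduce m v = w}))"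
    by (simp only: of_nat_le_iff flip: of_nat_sum)
  also have "\<dots> \<le> of_nat (card ?R) * (2 * real B / real_of_int m + 2) ^ 3"
    by (intro sum_bounded_above fibre)
  finally show ?thesis
    by simp
qed

section \<open>Divergence of the sum of reciprocals of primes\<close>

text \<open>Write $n = qs^2$ with $q$ squarefree.  If all prime factors of $n$ are below $K$, then $q$ is
  the product of a subset of $\{0, \dots, K-1\}$, and $s \le M$.\<close>

lemma card_smooth_le:
  fixes K M :: nat
  shows "card {n \<in> {1..M\<^sup>2}. \<forall>p. prime p \<longrightarrow> p dvd n \<longrightarrow> p < K} \<le> 2 ^ K * M"
proof -
  let ?Y = "{n \<in> {1..M\<^sup>2}. \<forall>p. prime p \<longrightarrow> p dvd n \<longrightarrow> p < K}"
  let ?f = "\<lambda>(T, s). \<Prod>T * s\<^sup>2 :: nat"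
  have "?Y \<subseteq> ?f ` (Pow {..<K} \<times> {1..M})"
  proof
    fix n assume n: "n \<in> ?Y"
    define q s where "q = squarefree_part n" and "s = square_part n"
    have nqs: "n = q * s\<^sup>2"
      using squarefree_decompose[of n] by (simp add: q_def s_def)
    have q0: "q \<noteq> 0" "s \<noteq> 0"
      using n nqs by (auto intro: ccontr)
    have "squarefree q"
      by (simp add: q_def)
    then have "(\<Prod>p\<in>prime_factors q. p ^ multiplicity p q) = \<Prod>(prime_factors q)"
      using q0 by (intro prod.cong refl) (simp add: squarefree_factorial_semiring')
    then have "q = \<Prod>(prime_factors q)"
      using q0 prod_prime_factors[of q] by simp
    moreover have "prime_factors q \<subseteq> {..<K}"
      using n nqs by (auto simp: in_prime_factors_iff)
    moreover have "s\<^sup>2 \<le> M\<^sup>2"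
      using n nqs q0 by (metis (no_types, lifting) atLeastAtMost_iff dvd_imp_le dvd_triv_right le_trans less_le_trans mem_Collect_eq zero_less_one)
    then have "s \<in> {1..M}"
      using q0 by (simp add: power2_nat_le_eq_le)
    ultimately show "n \<in> ?f ` (Pow {..<K} \<times> {1..M})"
      using nqs by (intro image_eqI[of _ _ "(prime_factors q, s)"]) auto
  qed
  then have "card ?Y \<le> card (Pow {..<K} \<times> {1..M})"
    by (intro surj_card_le) auto
  then show ?thesis
    by (simp add: card_cartesian_product card_Pow)
qed

text \<open>Erdos's argument: were the sum convergent, the primes from some $K$ on would have reciprocal
  sum below $1/2$, so fewer than half of the numbers up to $N$ would have a prime factor that is at
  least $K$.  But by the previous lemma only $2^K \sqrt N$ numbers have no such factor, which is at
  most $N/2$ for large $N$.\<close>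

lemma not_summable_prime_reciprocals:
  "\<not> summable (\<lambda>n::nat. if prime n then 1 / real n else 0)"
proof
  let ?f = "\<lambda>n::nat. if prime n then 1 / real n else 0"
  assume "summable ?f"
  then obtain K where K: "\<And>m n. m \<ge> K \<Longrightarrow> norm (sum ?f {m..<n}) < 1 / 2"
    unfolding summable_Cauchy by (meson zero_less_divide_1_iff zero_less_numeral)
  \<comment> \<open>the least $M$ with $2^K M \le M^2/2$\<close>
  define M :: nat where "M = 2 ^ (K + 1)"
  define N where "N = M\<^sup>2"
  let ?Y = "{n \<in> {1..M\<^sup>2}. \<forall>p. prime p \<longrightarrow> p dvd n \<longrightarrow> p < K}"
  let ?A = "\<lambda>p. {n \<in> {1..N}. p dvd n}"
  let ?Q = "{p \<in> {K..<N + 1}. prime p}"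
  have N: "N > 0"
    by (simp add: N_def M_def)
  have mult: "real (card (?A p)) \<le> real N / real p" if "p > 0" for p
  proof -
    have "?A p \<subseteq> (*) p ` {1..N div p}"
      using that by (auto elim!: dvdE simp: less_eq_div_iff_mult_less_eq mult.commute)
    then have "card (?A p) \<le> card {1..N div p}"
      by (intro surj_card_le) auto
    then show ?thesis
      using of_nat_div_le_of_nat[of N p, where 'a = real] by simp
  qed
  have "{1..N} \<subseteq> ?Y \<union> (\<Union>p\<in>?Q. ?A p)"
  proof
    fix n assume n: "n \<in> {1..N}"
    show "n \<in> ?Y \<union> (\<Union>p\<in>?Q. ?A p)"
    proof (cases "\<exists>p. prime p \<and> p dvd n \<and> K \<le> p")
      case True
      then obtain p where "prime p" "p dvd n" "K \<le> p"
        by blast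
      moreover from this have "p \<le> N"
        using n dvd_imp_le[of p n] by simp
      ultimately show ?thesis
        using n by auto
    next
      case False
      then show ?thesis
        using n by (auto simp: N_def not_le)
    qed
  qed
  then have "card {1..N} \<le> card (?Y \<union> (\<Union>p\<in>?Q. ?A p))"
    by (intro card_mono) auto
  also have "\<dots> \<le> card ?Y + card (\<Union>p\<in>?Q. ?A p)"
    by (rule card_Un_le)
  also have "\<dots> \<le> 2 ^ K * M + (\<Sum>p\<in>?Q. card (?A p))"
    by (intro add_mono card_smooth_le card_UN_le) auto
  finally have "real N \<le> real (2 ^ K * M) + (\<Sum>p\<in>?Q. real (card (?A p)))"
    by (simp only: card_atLeastAtMost diff_Suc_1 of_nat_le_iff flip: of_nat_sum of_nat_add)
  also have "(\<Sum>p\<in>?Q. real (card (?A p))) \<le> (\<Sum>p\<in>?Q. real N * (1 / real p))"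
    by (intro sum_mono) (use mult prime_gt_0_nat in force)
  also have "\<dots> = real N * sum ?f {K..<N + 1}"
    by (simp only: sum.inter_filter finite_atLeastLessThan flip: sum_distrib_left)
  also have "\<dots> < real N * (1 / 2)"
    using K[of K "N + 1"] N by (intro mult_strict_left_mono) auto
  also have "real (2 ^ K * M) = real N / 2"
    by (simp add: N_def M_def power2_eq_square)
  finally show False
    by simp
qed

lemma odd_prime_reciprocals_unbounded:
  "\<exists>S::int set. finite S \<and> (\<forall>p\<in>S. prime p \<and> p > 2) \<and> (\<Sum>p\<in>S. 1 / real_of_int p) > C"
proof -
  let ?f = "\<lambda>n::nat. if prime n then 1 / real n else 0"
  have "\<exists>N. sum ?f {..<N} > C + 1"
  proof (rule ccontr)
    assume "\<not> (\<exists>N. sum ?f {..<N} > C + 1)"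
    then have "sum ?f {..N} \<le> C + 1" for N
      by (metis lessThan_Suc_atMost not_less)
    then have "summable ?f"
      by (intro bounded_imp_summable[where B = "C + 1"]) auto
    then show False
      using not_summable_prime_reciprocals by blast
  qed
  then obtain N where N: "sum ?f {..<N} > C + 1" ..
  define T where "T = {p \<in> {..<N}. prime p \<and> p > 2}"
  have "sum ?f {..<N} = (\<Sum>p \<in> {p \<in> {..<N}. prime p}. 1 / real p)"
    by (rule sum.inter_filter[symmetric]) simp
  also have "\<dots> \<le> (\<Sum>p \<in> insert 2 T. 1 / real p)"
    by (intro sum_mono2) (auto simp: T_def dest: prime_ge_2_nat)
  also have "\<dots> = 1 / 2 + (\<Sum>p \<in> T. 1 / real p)"
    by (simp add: T_def)
  finally have "(\<Sum>p \<in> T. 1 / real p) > C"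
    using N by simp
  moreover have "(\<Sum>p \<in> int ` T. 1 / real_of_int p) = (\<Sum>p \<in> T. 1 / real p)"
    by (simp add: sum.reindex)
  ultimately show ?thesis
    by (intro exI[of _ "int ` T"]) (auto simp: T_def)
qed

section \<open>The density\<close>

lemma int_box_3: "int_box 3 B = (\<lambda>(a, b, c). [c, b, a]) ` ({- int B..<int B} \<times> {- int B..<int B} \<times> {- int B..<int B})"
proof (intro subset_antisym subsetI)
  fix v assume "v \<in> int_box 3 B"
  then obtain a b c where "v = [c, b, a]" "set v \<subseteq> {- int B..<int B}"
    by (auto simp: int_box_def numeral_3_eq_3 length_Suc_conv)
  then show "v \<in> (\<lambda>(a, b, c). [c, b, a]) ` ({- int B..<int B} \<times> {- int B..<int B} \<times> {- int B..<int B})"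
    by (intro image_eqI[of _ _ "(a, b, c)"]) auto
qed (auto simp: int_box_def)

lemma finite_int_box_3: "finite (int_box 3 B)"
  by (simp add: int_box_3)

lemma card_int_box_3: "card (int_box 3 B) = (2 * B) ^ 3"
proof -
  let ?I = "{- int B..<int B}"
  have "card (int_box 3 B) = card (?I \<times> ?I \<times> ?I)"
    unfolding int_box_3 by (intro card_image) (auto simp: inj_on_def)
  moreover have "card ?I = 2 * B"
    by simp
  ultimately show ?thesis
    by (simp only: card_cartesian_product power3_eq_cube mult.assoc)
qed

text \<open>For fixed $S$ the right-hand side is asymptotically $(2B)^3$ times the exponential factor, so
  that factor bounds the upper density of the complement.\<close>

lemma card_box_not_shifted_eisenstein_le:
  fixes S :: "int set"
  assumes S: "finite S" "\<And>p. p \<in> S \<Longrightarrow> prime p \<and> p > 2"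
  shows "real (card (int_box 3 B - coeff_vec 2 ` shifted_eisenstein_polys 2))
           \<le> exp (- 4 / 9 * (\<Sum>p\<in>S. 1 / real_of_int p))
               * (2 * real B + 2 * real_of_int (\<Prod>p\<in>S. p\<^sup>2)) ^ 3"
proof -
  let ?E = "coeff_vec 2 ` shifted_eisenstein_polys 2"
  let ?I = "{- int B..<int B}"
  let ?vec = "\<lambda>(a, b, c). [c, b, a] :: int list"
  define m where "m = (\<Prod>p\<in>S. p\<^sup>2)"
  define \<delta> where "\<delta> = exp (- 4 / 9 * (\<Sum>p\<in>S. 1 / real_of_int p))"
  define P where "P = (\<lambda>v. \<forall>p\<in>S. \<not> simple_disc_at p v)"
  let ?X = "{v \<in> ?I \<times> ?I \<times> ?I. P v}"
  have m: "m > 0"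
    unfolding m_def using S by (intro prod_pos) fastforce
  have per: "P (reduce m v) \<longleftrightarrow> P v" for v
    unfolding P_def m_def using S(1)
    by (intro ball_cong refl) (simp add: simple_disc_at_reduce dvd_prod_eqI)
  have "int_box 3 B - ?E \<subseteq> ?vec ` ?X"
  proof
    fix w assume w: "w \<in> int_box 3 B - ?E"
    then obtain a b c where abc: "w = [c, b, a]" "(a, b, c) \<in> ?I \<times> ?I \<times> ?I"
      by (auto simp: int_box_3)
    have "P (a, b, c)"
      using w abc(1) S(2) simple_disc_imp_shifted_eisenstein unfolding P_def by blast
    then show "w \<in> ?vec ` ?X"
      using abc by (intro image_eqI[of _ _ "(a, b, c)"]) auto
  qed
  then have "card (int_box 3 B - ?E) \<le> card ?X"
    by (intro surj_card_le) auto
  then have "real (card (int_box 3 B - ?E)) \<le> real (card ?X)"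
    by (rule of_nat_mono)
  also have "\<dots> \<le> real (card {v \<in> residues3 m. P v}) * (2 * real B / real_of_int m + 2) ^ 3"
    by (intro card_box_periodic_le m per)
  also have "\<dots> \<le> (real_of_int m ^ 3 * \<delta>) * (2 * real B / real_of_int m + 2) ^ 3"
  proof (intro mult_right_mono)
    show "real (card {v \<in> residues3 m. P v}) \<le> real_of_int m ^ 3 * \<delta>"
      unfolding m_def \<delta>_def P_def using S by (rule card_residues3_no_simple_disc_le)
  qed (use m in simp)
  also have "\<dots> = \<delta> * (real_of_int m * (2 * real B / real_of_int m + 2)) ^ 3"
    by (simp only: power_mult_distrib mult_ac)
  also have "real_of_int m * (2 * real B / real_of_int m + 2) = 2 * real B + 2 * real_of_int m"
    using m by (simp add: field_simps)
  finally show ?thesis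
    unfolding m_def \<delta>_def .
qed

theorem proposition10:
  shows "has_natural_density 3 (coeff_vec 2 ` shifted_eisenstein_polys 2) 1"
proof -
  define E where "E = coeff_vec 2 ` shifted_eisenstein_polys 2"
  define d where "d = (\<lambda>B. real (card (E \<inter> int_box 3 B)) / (2 * real B) ^ 3)"
  have complement: "real (card (E \<inter> int_box 3 B)) = (2 * real B) ^ 3 - real (card (int_box 3 B - E))" for B
  proof -
    have "card (int_box 3 B) = card (E \<inter> int_box 3 B) + card (int_box 3 B - E)"
      using card_Int_Diff[OF finite_int_box_3, of B E] by (simp add: Int_commute)
    then show ?thesis
      unfolding card_int_box_3 by (simp flip: of_nat_add of_nat_mult of_nat_power)
  qed
  have upper: "d B \<le> 1" for B
    unfolding d_def complement by (rule divide_le_eq_1[THEN iffD2]) (cases "B = 0"; simp)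
  have lower: "eventually (\<lambda>B. y < d B) sequentially" if y: "y < 1" for y :: real
  proof -
    obtain S :: "int set" where S: "finite S" "\<And>p. p \<in> S \<Longrightarrow> prime p \<and> p > 2"
      and sum: "(\<Sum>p\<in>S. 1 / real_of_int p) > - (9 / 4) * ln (1 - y)"
      using odd_prime_reciprocals_unbounded[of "- (9 / 4) * ln (1 - y)"]
      by (elim exE conjE bspec) blast
    \<comment> \<open>the set \<open>S\<close> is large enough for the exponential factor to be below $1 - y$\<close>
    define m where "m = real_of_int (\<Prod>p\<in>S. p\<^sup>2)"
    define \<delta> where "\<delta> = exp (- 4 / 9 * (\<Sum>p\<in>S. 1 / real_of_int p))"
    have "- 4 / 9 * (\<Sum>p\<in>S. 1 / real_of_int p) < ln (1 - y)"
      using sum by simp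
    then have "\<delta> < exp (ln (1 - y))"
      unfolding \<delta>_def by (rule exp_less_mono)
    then have \<delta>: "y < 1 - \<delta>"
      using y by simp
    have bound: "1 - \<delta> * (1 + m / real B) ^ 3 \<le> d B" if B: "B > 0" for B
    proof -
      have "real (card (int_box 3 B - E)) \<le> \<delta> * (2 * real B + 2 * m) ^ 3"
        unfolding E_def \<delta>_def m_def by (rule card_box_not_shifted_eisenstein_le[OF S])
      also have "2 * real B + 2 * m = (1 + m / real B) * (2 * real B)"
        using B by (simp add: field_simps)
      finally have "real (card (int_box 3 B - E)) \<le> \<delta> * (1 + m / real B) ^ 3 * (2 * real B) ^ 3"
        by (simp only: power_mult_distrib mult.assoc)
      then have "real (card (int_box 3 B - E)) / (2 * real B) ^ 3 \<le> \<delta> * (1 + m / real B) ^ 3"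
        using B by (intro divide_le_eq[THEN iffD2]) simp
      then show ?thesis
        unfolding d_def complement using B by (simp add: diff_divide_distrib)
    qed
    have "(\<lambda>B. 1 - \<delta> * (1 + m / real B) ^ 3) \<longlonglongrightarrow> 1 - \<delta> * (1 + 0) ^ 3"
      by (intro tendsto_intros lim_const_over_n)
    then have "eventually (\<lambda>B. y < 1 - \<delta> * (1 + m / real B) ^ 3) sequentially"
      by (rule order_tendstoD(1)) (use \<delta> in simp)
    then show ?thesis
      using eventually_gt_at_top[of 0]
    proof eventually_elim
      case (elim B)
      then show ?case
        using bound[of B] by linarith
    qed
  qed
  have "d \<longlonglongrightarrow> 1"
  proof (rule order_tendstoI)
    show "eventually (\<lambda>B. d B < y) sequentially" if "1 < y" for y
      using le_less_trans[OF upper that] by (rule always_eventually[OF allI])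
  qed (rule lower)
  then show ?thesis
    by (simp only: has_natural_density_def d_def E_def)
qed

end
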